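(* Let $n\ge 1$. The number $y(n)$ of permutations in the Bruhat interval $[w_{\rm up},w_\square]\subseteq S_{2n}$ is the median Genocchi number $H_{2n+1}$.
   Context: In one-line notation $w_\square=(n+1)(n+2)\cdots(2n)\,1\,2\cdots n$ and $w_{\rm up}=1\,2\cdots n\,(2n)(2n-1)\cdots(n+1)$ in $S_{2n}$; the interval is with respect to (strong) Bruhat order. (The number $y(n)$ is equivalently the number of irreducible strata in a certain determinantal stratification of the space of upper triangular $n\times n$ matrices.) The median Genocchi numbers are defined by the Seidel triangle: define numbers $s_{k,i}$ for $k\ge0$, $1\le i\le (k+3)/2$ by $s_{0,1}=1$ and, for $k\geq 1$, $$s_{2k-1,i}=s_{2k-2,i}+s_{2k-1,i-1},\qquad s_{2k,i}=s_{2k-1,i}+s_{2k,i+1},$$ where summands with out-of-range indices are interpreted as $0$. Then $H_{2n+1}=s_{2n,1}$ (so $H_1,H_3,H_5,H_7=1,2,8,56$). *)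

theory Defs
  imports "HOL-Combinatorics.Permutations"
begin

text \<open>The symmetric group \<open>S\<^sub>N\<close> is the set of functions \<open>w :: nat \<Rightarrow> nat\<close> with
  \<open>w permutes {1..N}\<close>, so \<open>w i = i\<close> outside \<open>{1..N}\<close>.\<close>

definition one_line :: "nat list \<Rightarrow> nat \<Rightarrow> nat" where
  "one_line xs i = (if i \<in> {1..length xs} then xs ! (i - 1) else i)"

text \<open>Coxeter length of a permutation, as its number of inversions.\<close>

definition perm_length :: "nat \<Rightarrow> (nat \<Rightarrow> nat) \<Rightarrow> nat" where
  "perm_length N w = card {(i, j). 1 \<le> i \<and> i < j \<and> j \<le> N \<and> w i > w j}"

text \<open>Strong Bruhat order: the reflexive transitive closure of multiplication by an arbitrary
  (not necessarily adjacent) transposition that increases the length.\<close>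

definition bruhat_step :: "nat \<Rightarrow> (nat \<Rightarrow> nat) \<Rightarrow> (nat \<Rightarrow> nat) \<Rightarrow> bool" where
  "bruhat_step N u v \<longleftrightarrow>
     (\<exists>a b. 1 \<le> a \<and> a < b \<and> b \<le> N \<and> v = u \<circ> transpose a b) \<and>
     perm_length N u < perm_length N v"

definition bruhat_le :: "nat \<Rightarrow> (nat \<Rightarrow> nat) \<Rightarrow> (nat \<Rightarrow> nat) \<Rightarrow> bool" where
  "bruhat_le N = (bruhat_step N)\<^sup>*\<^sup>*"

definition bruhat_interval :: "nat \<Rightarrow> (nat \<Rightarrow> nat) \<Rightarrow> (nat \<Rightarrow> nat) \<Rightarrow> (nat \<Rightarrow> nat) set" where
  "bruhat_interval N u w = {v. v permutes {1..N} \<and> bruhat_le N u v \<and> bruhat_le N v w}"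

definition w_square :: "nat \<Rightarrow> nat \<Rightarrow> nat" where
  "w_square n = one_line ([n + 1..<2 * n + 1] @ [1..<n + 1])"

definition w_up :: "nat \<Rightarrow> nat \<Rightarrow> nat" where
  "w_up n = one_line ([1..<n + 1] @ rev [n + 1..<2 * n + 1])"

text \<open>The Seidel triangle \<open>s\<^sub>k\<^sub>,\<^sub>i\<close>, extended by \<open>0\<close> outside \<open>1 \<le> i \<le> (k + 3) / 2\<close>. Odd rows
  are computed from left to right, even rows from right to left.\<close>

function seidel :: "nat \<Rightarrow> nat \<Rightarrow> nat" where
  "seidel k i =
     (if i = 0 \<or> 2 * i > k + 3 then 0
      else if k = 0 then 1
      else if odd k then seidel (k - 1) i + seidel k (i - 1)
      else seidel (k - 1) i + seidel k (i + 1))"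
  by pat_completeness auto
termination
  by (relation "measures [fst, \<lambda>(k, i). if odd k then i else k + 3 - i]") auto

declare seidel.simps [simp del]

lemma seidel_0_1: "seidel 0 1 = 1"
  by (subst seidel.simps) simp

lemma seidel_out_of_range: "i = 0 \<or> 2 * i > k + 3 \<Longrightarrow> seidel k i = 0"
  by (subst seidel.simps) (rule if_P)

lemma seidel_odd_row:
  assumes "k \<ge> 1" "1 \<le> i" "2 * i \<le> (2 * k - 1) + 3"
  shows "seidel (2 * k - 1) i = seidel (2 * k - 2) i + seidel (2 * k - 1) (i - 1)"
proof -
  have "\<not> (i = 0 \<or> 2 * i > (2 * k - 1) + 3)" "2 * k - 1 \<noteq> 0" "odd (2 * k - 1)"
    "2 * k - 1 - 1 = 2 * k - 2"
    using assms by auto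
  then show ?thesis
    by (simp only: seidel.simps [of "2 * k - 1" i] if_True if_False simp_thms)
qed

lemma seidel_even_row:
  assumes "k \<ge> 1" "1 \<le> i" "2 * i \<le> 2 * k + 3"
  shows "seidel (2 * k) i = seidel (2 * k - 1) i + seidel (2 * k) (i + 1)"
proof -
  have "\<not> (i = 0 \<or> 2 * i > 2 * k + 3)" "2 * k \<noteq> 0" "\<not> odd (2 * k)"
    using assms by auto
  then show ?thesis by (simp only: seidel.simps [of "2 * k" i] if_False)
qed

text \<open>The median Genocchi numbers \<open>H\<^sub>m\<close>; only odd indices \<open>m = 2 * n + 1\<close> are meaningful.\<close>

definition median_genocchi :: "nat \<Rightarrow> nat" where
  "median_genocchi m = seidel (m - 1) 1"

lemma median_genocchi_odd: "median_genocchi (2 * n + 1) = seidel (2 * n) 1"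
  by (simp add: median_genocchi_def)

lemma median_genocchi_values:
  "median_genocchi 1 = 1" "median_genocchi 3 = 2"
  "median_genocchi 5 = 8" "median_genocchi 7 = 56"
  by code_simp+

end

theory Submission
  imports Defs
begin

text \<open>
  The Bruhat order on a symmetric group is the pointwise order of rank functions
  (\<open>bruhat_le_iff_rank_le\<close>). For the two endpoints at hand the rank inequalities collapse to bounds on
  single entries: \<open>w\<close> lies in the interval iff \<open>w i \<le> n + i\<close> for \<open>i \<le> n\<close>, and
  \<open>i - n \<le> w i \<le> 3 n + 1 - i\<close> for \<open>i > n\<close> (\<open>bruhat_interval_eq_board_perms\<close>). So the task is to count
  the permutation matrices supported on a board.

  The rows of the board are treated in pairs, \<open>2 n - t\<close> and \<open>t + 1\<close> for \<open>t = 0, \<dots>, n - 1\<close>, while the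
  values become available from the middle outwards. A row \<open>t + 1 \<le> n\<close> that is to receive a value up to
  \<open>n\<close> is deferred to the end, since any such value is allowed there. The number of completions then depends
  on the number \<open>m\<close> of remaining steps and the numbers \<open>a\<close>, \<open>b\<close> of unused available values above and up
  to \<open>n\<close> only, and satisfies a recursion (\<open>card_extensions\<close>). The recursion is solved by \<open>(T\<^sup>m w)(0)\<close>, where \<open>T\<close> maps \<open>h\<close> to the forward
  difference of \<open>j (j + 1) h(j)\<close> and \<open>w(j)\<close> is the product of a falling factorial of length \<open>a\<close> and
  a rising factorial of length \<open>b\<close> (\<open>placements_genocchi_op\<close>). So the interval has \<open>(T\<^sup>n 1)(0)\<close>
  elements.

  It remains to find \<open>(T\<^sup>n 1)(0)\<close> in the Seidel triangle. Adjoin to \<open>T\<close> an element \<open>x\<close> with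
  \<open>x (x + 1) = - T\<close> and let \<open>N\<close> be the functional
  \<open>x q\<^sub>1(T) + q\<^sub>0(T) \<mapsto> (q\<^sub>1(T) 1)(0)\<close>. Up to the sign \<open>(- 1)\<^sup>n\<close>, the entries of row \<open>2 n\<close> are the numbers
  \<open>N(x\<^sup>n\<^sup>+\<^sup>i (x + 1)\<^sup>n\<^sup>+\<^sup>1\<^sup>-\<^sup>i)\<close>, and those of row \<open>2 n - 1\<close> are \<open>N(x\<^sup>n\<^sup>+\<^sup>i (x + 1)\<^sup>n\<^sup>-\<^sup>i)\<close> for \<open>i \<le> n\<close>, the last one being repeated. The
  recurrences of the triangle hold because \<open>(x + 1) - x = 1\<close>. The boundary conditions amount to
  \<open>N(x\<^sup>n (x + 1)\<^sup>n) = 0\<close>, which is clear, and \<open>N((x - 1) x\<^sup>2\<^sup>n) = 0\<close> for \<open>n \<ge> 1\<close>, which follows from an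
  invariant of multiplication by \<open>x\<^sup>2\<close> (\<open>moment_edge\<close>). The entry \<open>i = 1\<close> of row \<open>2 n\<close> is
  \<open>(T\<^sup>n 1)(0)\<close>.
\<close>

section \<open>The Bruhat order in terms of ranks\<close>

text \<open>The map \<open>f\<close> sends inversions of \<open>w\<close> injectively to inversions of \<open>w \<circ> transpose a b\<close>:
  it applies the transposition to both positions if this keeps them in order and fixes the pair
  otherwise. The new inversion \<open>(a, b)\<close> is not in its image.\<close>

lemma perm_length_less_transpose:
  assumes w: "w permutes {1..N}" and ab: "1 \<le> a" "a < b" "b \<le> N" and less: "w a < w b"
  shows "perm_length N w < perm_length N (w \<circ> transpose a b)"
proof -
  let ?t = "transpose a b"
  let ?I = "\<lambda>v :: nat \<Rightarrow> nat. {(i, j). 1 \<le> i \<and> i < j \<and> j \<le> N \<and> v i > v j}"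
  define f where "f = (\<lambda>(i, j). if ?t i < ?t j then (?t i, ?t j) else (i, j))"
  have t: "?t i = (if i = a then b else if i = b then a else i)" for i
    by (simp add: transpose_def)
  have tt: "?t (?t i) = i" for i by simp
  have range: "1 \<le> ?t i \<and> ?t i \<le> N" if "1 \<le> i" "i \<le> N" for i
    using that ab by (simp add: t)
  have fin: "finite (?I v)" for v
    by (rule finite_subset[of _ "{1..N} \<times> {1..N}"]) auto
  have maps: "f p \<in> ?I (w \<circ> ?t)" if "p \<in> ?I w" for p
  proof -
    obtain i j where p: "p = (i, j)" by fastforce
    then have ij: "1 \<le> i" "i < j" "j \<le> N" "w j < w i" using that by auto
    show ?thesis
    proof (cases "?t i < ?t j")
      case True
      then show ?thesis using ij range[of i] range[of j] by (simp add: p f_def)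
    next
      case False
      have "(w \<circ> ?t) j < (w \<circ> ?t) i"
        using False ij ab less by (auto simp: t split: if_splits)
      then show ?thesis using False ij by (simp add: p f_def)
    qed
  qed
  have inj: "inj_on f (?I w)"
  proof (rule inj_onI)
    fix p q assume pq: "p \<in> ?I w" "q \<in> ?I w" "f p = f q"
    obtain i j k l where "p = (i, j)" "q = (k, l)" by (metis surj_pair)
    then show "p = q"
      using pq by (auto simp: f_def transpose_eq_iff split: if_splits)
  qed
  have notin: "(a, b) \<notin> f ` ?I w"
    using ab less by (auto simp: f_def t split: if_splits)
  have inI: "(a, b) \<in> ?I (w \<circ> ?t)" using ab less by (simp add: t)
  have sub: "f ` ?I w \<subseteq> ?I (w \<circ> ?t)" using maps by (rule image_subsetI)
  have "f ` ?I w \<noteq> ?I (w \<circ> ?t)" 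
  proof
    assume eq: "f ` ?I w = ?I (w \<circ> ?t)"
    show False using notin inI unfolding eq by (rule notE)
  qed
  with sub have "f ` ?I w \<subset> ?I (w \<circ> ?t)" by (rule psubsetI)
  then have "card (f ` ?I w) < card (?I (w \<circ> ?t))" by (rule psubset_card_mono[OF fin])
  then have "card (?I w) < card (?I (w \<circ> ?t))" unfolding card_image[OF inj] .
  then show ?thesis by (simp add: perm_length_def)
qed

lemma bruhat_step_iff:
  assumes "u permutes {1..N}"
  shows "bruhat_step N u v \<longleftrightarrow>
    (\<exists>a b. 1 \<le> a \<and> a < b \<and> b \<le> N \<and> u a < u b \<and> v = u \<circ> transpose a b)"
proof
  assume "bruhat_step N u v"
  then obtain a b where ab: "1 \<le> a" "a < b" "b \<le> N" and v: "v = u \<circ> transpose a b"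
    and len: "perm_length N u < perm_length N v"
    unfolding bruhat_step_def by blast
  have "u a < u b"
  proof (rule ccontr)
    assume "\<not> u a < u b"
    moreover have "u a \<noteq> u b" using permutes_inj[OF assms] ab(2) by (auto dest: injD)
    ultimately have "v a < v b" by (simp add: v)
    moreover have "v permutes {1..N}"
      unfolding v using ab assms by (intro permutes_compose permutes_swap_id) auto
    ultimately have "perm_length N v < perm_length N (v \<circ> transpose a b)"
      using ab by (intro perm_length_less_transpose)
    moreover have "v \<circ> transpose a b = u" by (simp add: v fun_eq_iff)
    ultimately show False using len by simp
  qed
  then show "\<exists>a b. 1 \<le> a \<and> a < b \<and> b \<le> N \<and> u a < u b \<and> v = u \<circ> transpose a b"
    using ab v by blast
next
  assume "\<exists>a b. 1 \<le> a \<and> a < b \<and> b \<le> N \<and> u a < u b \<and> v = u \<circ> transpose a b"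
  then show "bruhat_step N u v"
    unfolding bruhat_step_def using perm_length_less_transpose[OF assms] by blast
qed

lemma bruhat_step_permutes:
  assumes "u permutes {1..N}" "bruhat_step N u v"
  shows "v permutes {1..N}"
  using assms unfolding bruhat_step_def by (auto intro!: permutes_compose permutes_swap_id)

text \<open>\<open>rank w i j\<close> counts the positions at most \<open>i\<close> that carry a value at least \<open>j\<close>.\<close>

definition rank :: "(nat \<Rightarrow> nat) \<Rightarrow> nat \<Rightarrow> nat \<Rightarrow> nat" where
  "rank w i j = card {c \<in> {1..i}. j \<le> w c}"

lemma rank_transpose:
  assumes "1 \<le> a" "a < b" "u a < u b"
  shows "rank (u \<circ> transpose a b) i j =
    rank u i j + (if a \<le> i \<and> i < b \<and> u a < j \<and> j \<le> u b then 1 else 0)"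
proof -
  let ?t = "transpose a b"
  let ?S = "\<lambda>w. {c \<in> {1..i}. j \<le> (w :: nat \<Rightarrow> nat) c}"
  have t: "?t c = (if c = a then b else if c = b then a else c)" for c
    by (simp add: transpose_def)
  consider "i < a" | "a \<le> i" "i < b" | "b \<le> i" by linarith
  then show ?thesis
  proof cases
    case 1
    then have "?S (u \<circ> ?t) = ?S u" using assms by (auto simp: t)
    then show ?thesis using 1 by (simp add: rank_def)
  next
    case 2
    show ?thesis
    proof (cases "u a < j \<and> j \<le> u b")
      case True
      then have "?S (u \<circ> ?t) = insert a (?S u)" using assms 2 by (auto simp: t)
      moreover have "a \<notin> ?S u" using True by simp
      ultimately show ?thesis using 2 True by (simp add: rank_def)
    next
      case False
      then have "?S (u \<circ> ?t) = ?S u" using assms 2 by (auto simp: t)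
      then show ?thesis using False unfolding rank_def by auto
    qed
  next
    case 3
    have "bij_betw ?t (?S (u \<circ> ?t)) (?S u)"
      by (rule bij_betwI[of _ _ _ ?t]) (use assms 3 in \<open>auto simp: t\<close>)
    then show ?thesis using 3 by (simp add: rank_def bij_betw_same_card)
  qed
qed

lemma bruhat_le_imp_rank_le:
  assumes "bruhat_le N u v" "u permutes {1..N}"
  shows "v permutes {1..N} \<and> (\<forall>i j. rank u i j \<le> rank v i j)"
  using assms(1) unfolding bruhat_le_def
proof (induction rule: rtranclp_induct)
  case base
  then show ?case using assms(2) by simp
next
  case (step v w)
  then have v: "v permutes {1..N}" by simp
  then obtain a b where "1 \<le> a" "a < b" "v a < v b" "w = v \<circ> transpose a b"
    using step.hyps(2) bruhat_step_iff by blast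
  then have "rank v i j \<le> rank w i j" for i j using rank_transpose[of a b v i j] by simp
  then show ?case using step bruhat_step_permutes[OF v step.hyps(2)] by (meson le_trans)
qed

text \<open>The step swaps the first position \<open>a\<close> at which \<open>u\<close> and \<open>v\<close> differ with the first later
  position \<open>b\<close> whose value lies in \<open>{u a<..v a}\<close>. Only the ranks in \<open>{a..<b} \<times> {u a<..u b}\<close> grow,
  each by one. There the inequality of ranks is strict, because \<open>v\<close> has the additional entry \<open>v a\<close>
  in position \<open>a\<close> and, by minimality of \<open>b\<close>, nothing compensates for it in \<open>u\<close>.\<close>

lemma exists_bruhat_step_rank_le:
  assumes u: "u permutes {1..N}" and v: "v permutes {1..N}" and "u \<noteq> v"
    and le: "\<And>i j. rank u i j \<le> rank v i j"
  shows "\<exists>u'. bruhat_step N u u' \<and> (\<forall>i j. rank u' i j \<le> rank v i j)"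
proof -
  define a where "a = (LEAST i. u i \<noteq> v i)"
  have "\<exists>i. u i \<noteq> v i" using \<open>u \<noteq> v\<close> by blast
  then have neq: "u a \<noteq> v a" unfolding a_def by (rule LeastI_ex)
  have eq: "u c = v c" if "c < a" for c using not_less_Least[of c "\<lambda>i. u i \<noteq> v i"] that a_def by blast
  have a: "1 \<le> a" "a \<le> N"
    using neq permutes_not_in[OF u, of a] permutes_not_in[OF v, of a] by force+
  have less: "u a < v a"
  proof (rule ccontr)
    assume "\<not> u a < v a"
    then have "{c \<in> {1..a}. u a \<le> u c} = insert a {c \<in> {1..<a}. u a \<le> v c}"
      "{c \<in> {1..a}. u a \<le> v c} = {c \<in> {1..<a}. u a \<le> v c}"
      using eq neq a by (auto simp: le_less)
    then show False using le[of a "u a"] by (simp add: rank_def)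
  qed
  define b where "b = (LEAST c. a < c \<and> u a < u c \<and> u c \<le> v a)"
  obtain c where c: "u c = v a" using permutes_surj[OF u] by (metis surjD)
  have "a < c"
  proof (rule ccontr)
    assume "\<not> a < c"
    then have "c < a" using c neq by (cases "c = a") auto
    then have "v c = v a" using eq c by simp
    then show False using injD[OF permutes_inj[OF v]] \<open>c < a\<close> by blast
  qed
  then have "\<exists>c. a < c \<and> u a < u c \<and> u c \<le> v a" using c less by auto
  then have b: "a < b" "u a < u b" "u b \<le> v a" unfolding b_def by (metis (mono_tags, lifting) LeastI_ex)+
  have between: "\<not> (u a < u c \<and> u c \<le> v a)" if "a < c" "c < b" for c
    using not_less_Least[of c "\<lambda>c. a < c \<and> u a < u c \<and> u c \<le> v a"] that b_def by blast
  have "b \<le> N"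
  proof (rule ccontr)
    assume "\<not> b \<le> N"
    then have "u b = b" using permutes_not_in[OF u] by simp
    moreover have "v a \<le> N" using permutes_in_image[OF v, of a] a by simp
    ultimately show False using b(3) \<open>\<not> b \<le> N\<close> by simp
  qed
  have rank_split: "rank w i j = rank w i (v a + 1) + card {c \<in> {1..i}. j \<le> w c \<and> w c \<le> v a}"
    if "j \<le> v a + 1" for w i j
  proof -
    have "{c \<in> {1..i}. j \<le> w c} = {c \<in> {1..i}. v a + 1 \<le> w c} \<union> {c \<in> {1..i}. j \<le> w c \<and> w c \<le> v a}"
      using that by auto
    then show ?thesis unfolding rank_def by (simp add: card_Un_disjoint disjoint_iff)
  qed
  have "rank (u \<circ> transpose a b) i j \<le> rank v i j" for i j
  proof (cases "a \<le> i \<and> i < b \<and> u a < j \<and> j \<le> u b")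
    case False
    then show ?thesis unfolding rank_transpose[OF a(1) b(1,2)] if_not_P[OF False] using le[of i j] by simp
  next
    case True
    let ?A = "{c \<in> {1..i}. j \<le> u c \<and> u c \<le> v a}" and ?B = "{c \<in> {1..i}. j \<le> v c \<and> v c \<le> v a}"
    have j: "j \<le> v a + 1" using True b by simp
    have "?A \<subseteq> ?B - {a}"
    proof
      fix c assume "c \<in> ?A"
      then have "c < a" using True between[of c] by (cases c a rule: linorder_cases) auto
      then show "c \<in> ?B - {a}" using \<open>c \<in> ?A\<close> eq by simp
    qed
    moreover have "a \<in> ?B" using True a b by simp
    ultimately have "card ?A < card ?B" by (intro psubset_card_mono) auto
    then have "rank u i j < rank v i j"
      using rank_split[OF j, of u i] rank_split[OF j, of v i] le[of i "v a + 1"] by linarith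
    then show ?thesis unfolding rank_transpose[OF a(1) b(1,2)] by simp
  qed
  moreover have "bruhat_step N u (u \<circ> transpose a b)"
    using bruhat_step_iff[OF u] a b \<open>b \<le> N\<close> by blast
  ultimately show ?thesis by blast
qed

lemma perm_length_le: "perm_length N w \<le> N * N"
proof -
  have "perm_length N w \<le> card ({1..N} \<times> {1..N})"
    unfolding perm_length_def by (rule card_mono) auto
  then show ?thesis by simp
qed

lemma rank_le_imp_bruhat_le:
  assumes "u permutes {1..N}" "v permutes {1..N}" "\<And>i j. rank u i j \<le> rank v i j"
  shows "bruhat_le N u v"
  using assms(1,3)
proof (induction "N * N - perm_length N u" arbitrary: u rule: less_induct)
  case less
  show ?case
  proof (cases "u = v")
    case False
    then obtain u' where step: "bruhat_step N u u'" and le: "\<And>i j. rank u' i j \<le> rank v i j"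
      using exists_bruhat_step_rank_le[OF less.prems(1) assms(2)] less.prems(2) by blast
    have "perm_length N u < perm_length N u'" using step by (simp add: bruhat_step_def)
    then have "N * N - perm_length N u' < N * N - perm_length N u"
      using perm_length_le[of N u'] by linarith
    then have "bruhat_le N u' v"
      using less.hyps le bruhat_step_permutes[OF less.prems(1) step] by blast
    then show ?thesis
      using step unfolding bruhat_le_def by (meson converse_rtranclp_into_rtranclp)
  qed (simp add: bruhat_le_def)
qed

lemma bruhat_le_iff_rank_le:
  assumes "u permutes {1..N}" "v permutes {1..N}"
  shows "bruhat_le N u v \<longleftrightarrow> (\<forall>i j. rank u i j \<le> rank v i j)"
  using bruhat_le_imp_rank_le rank_le_imp_bruhat_le assms by blast

lemma rank_add_corank:
  assumes "w permutes {1..N}" "i \<le> N"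
  shows "rank w i j + card {c \<in> {i + 1..N}. j \<le> w c} = card {c \<in> {1..N}. j \<le> c}"
proof -
  have "{1..N} = {1..i} \<union> {i + 1..N}" using assms(2) by auto
  then have "{c \<in> {1..N}. j \<le> w c} = {c \<in> {1..i}. j \<le> w c} \<union> {c \<in> {i + 1..N}. j \<le> w c}" by auto
  then have "rank w i j + card {c \<in> {i + 1..N}. j \<le> w c} = card {c \<in> {1..N}. j \<le> w c}"
    unfolding rank_def by (simp add: card_Un_disjoint disjoint_iff)
  also have "\<dots> = card (w ` {c \<in> {1..N}. j \<le> w c})"
    by (rule card_image[symmetric]) (rule inj_on_subset[OF permutes_inj[OF assms(1)]], simp)
  also have "w ` {c \<in> {1..N}. j \<le> w c} = {c \<in> {1..N}. j \<le> c}"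
  proof
    show "w ` {c \<in> {1..N}. j \<le> w c} \<subseteq> {c \<in> {1..N}. j \<le> c}"
      using permutes_image[OF assms(1)] by blast
    show "{c \<in> {1..N}. j \<le> c} \<subseteq> w ` {c \<in> {1..N}. j \<le> w c}"
    proof
      fix x assume x: "x \<in> {c \<in> {1..N}. j \<le> c}"
      then obtain c where "c \<in> {1..N}" "x = w c" using permutes_image[OF assms(1)] by blast
      then show "x \<in> w ` {c \<in> {1..N}. j \<le> w c}" using x by blast
    qed
  qed
  finally show ?thesis .
qed

lemma rank_beyond:
  assumes "w permutes {1..N}" "v permutes {1..N}" "N \<le> i"
  shows "rank w i j = rank v i j"
proof -
  have "w permutes {1..i}" "v permutes {1..i}"
    using assms by (auto intro: permutes_subset)
  then show ?thesis using rank_add_corank[of w i i j] rank_add_corank[of v i i j] by simp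
qed

section \<open>The interval as a board\<close>

lemma one_line_permutes:
  assumes "distinct xs" "set xs = {1..N}"
  shows "one_line xs permutes {1..N}"
proof (rule bij_imp_permutes)
  have len: "length xs = N" using distinct_card[OF assms(1)] assms(2) by simp
  have "bij_betw ((!) xs) {..<N} {1..N}" using bij_betw_nth[OF assms(1)] len assms(2) by simp
  moreover have "bij_betw (\<lambda>i. i - 1) {1..N} {..<N}"
    by (rule bij_betwI[of _ _ _ Suc]) auto
  ultimately have "bij_betw ((!) xs \<circ> (\<lambda>i. i - 1)) {1..N} {1..N}" by (rule bij_betw_trans[rotated])
  then show "bij_betw (one_line xs) {1..N} {1..N}"
    by (rule bij_betw_cong[THEN iffD1, rotated]) (simp add: one_line_def len)
next
  have "length xs = N" using distinct_card[OF assms(1)] assms(2) by simp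
  then show "one_line xs i = i" if "i \<notin> {1..N}" for i using that by (simp only: one_line_def if_False)
qed

lemma w_square_permutes: "w_square n permutes {1..2 * n}"
  unfolding w_square_def by (rule one_line_permutes) auto

lemma w_up_permutes: "w_up n permutes {1..2 * n}"
  unfolding w_up_def by (rule one_line_permutes) auto

lemma w_square_low: "1 \<le> i \<Longrightarrow> i \<le> n \<Longrightarrow> w_square n i = n + i"
  by (auto simp: w_square_def one_line_def nth_append simp del: upt_Suc)

lemma w_square_high: "n < i \<Longrightarrow> i \<le> 2 * n \<Longrightarrow> w_square n i = i - n"
  by (auto simp: w_square_def one_line_def nth_append simp del: upt_Suc)

lemma w_up_low: "1 \<le> i \<Longrightarrow> i \<le> n \<Longrightarrow> w_up n i = i"
  by (auto simp: w_up_def one_line_def nth_append simp del: upt_Suc)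

lemma w_up_high: "n < i \<Longrightarrow> i \<le> 2 * n \<Longrightarrow> w_up n i = 3 * n + 1 - i"
  by (auto simp: w_up_def one_line_def nth_append rev_nth simp del: upt_Suc)

text \<open>Up to position \<open>n\<close> the ranks of \<open>w_square n\<close> are compared directly, beyond it through the
  complementary counts of \<open>rank_add_corank\<close>.\<close>

lemma rank_le_w_square_iff:
  assumes w: "w permutes {1..2 * n}"
  shows "(\<forall>i j. rank w i j \<le> rank (w_square n) i j) \<longleftrightarrow>
    (\<forall>i\<in>{1..n}. w i \<le> n + i) \<and> (\<forall>i\<in>{n + 1..2 * n}. i \<le> n + w i)"
    (is "?L \<longleftrightarrow> ?R1 \<and> ?R2")
proof
  assume le: ?L
  show "?R1 \<and> ?R2"
  proof (intro conjI ballI)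
    fix i assume i: "i \<in> {1..n}"
    have "{c \<in> {1..i}. n + i + 1 \<le> w_square n c} = {}" using i by (auto simp: w_square_low)
    then have "rank (w_square n) i (n + i + 1) = 0" unfolding rank_def by (metis card.empty)
    then have "rank w i (n + i + 1) = 0" using le by (metis le_zero_eq)
    then have "{c \<in> {1..i}. n + i + 1 \<le> w c} = {}" by (simp add: rank_def)
    then show "w i \<le> n + i" using i by (metis (mono_tags, lifting) atLeastAtMost_iff empty_iff
      mem_Collect_eq not_less_eq_eq Suc_eq_plus1 order_refl)
  next
    fix i assume i: "i \<in> {n + 1..2 * n}"
    let ?C = "\<lambda>v :: nat \<Rightarrow> nat. {c \<in> {i..2 * n}. i - n \<le> v c}"
    have i1: "i - 1 \<le> 2 * n" "i - 1 + 1 = i" using i by auto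
    have "rank v (i - 1) (i - n) + card (?C v) = card {c \<in> {1..2 * n}. i - n \<le> c}"
      if "v permutes {1..2 * n}" for v
      using rank_add_corank[OF that i1(1), of "i - n"] unfolding i1(2) .
    from this[OF w] this[OF w_square_permutes] have "card (?C (w_square n)) \<le> card (?C w)"
      using le[rule_format, of "i - 1" "i - n"] by linarith
    moreover have "?C (w_square n) = {i..2 * n}" using i by (auto simp: w_square_high)
    ultimately have "card {i..2 * n} \<le> card (?C w)" by (simp only:)
    then have "?C w = {i..2 * n}" by (rule card_seteq[rotated 2]) auto
    moreover have "i \<in> {i..2 * n}" using i by simp
    ultimately have "i - n \<le> w i" by blast
    then show "i \<le> n + w i" by linarith
  qed
next
  assume R: "?R1 \<and> ?R2"
  show ?L
  proof (intro allI)
    fix i j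
    consider "i \<le> n" | "n < i" "i \<le> 2 * n" | "2 * n \<le> i" by linarith
    then show "rank w i j \<le> rank (w_square n) i j"
    proof cases
      case 1
      have "{c \<in> {1..i}. j \<le> w c} \<subseteq> {c \<in> {1..i}. j \<le> w_square n c}"
        using 1 R by (force simp: w_square_low)
      then show ?thesis unfolding rank_def by (intro card_mono) auto
    next
      case 2
      have "{c \<in> {i + 1..2 * n}. j \<le> w_square n c} \<subseteq> {c \<in> {i + 1..2 * n}. j \<le> w c}"
      proof
        fix c assume c: "c \<in> {c \<in> {i + 1..2 * n}. j \<le> w_square n c}"
        then have "j \<le> c - n" using 2 w_square_high[of n c] by simp
        moreover have "c \<le> n + w c" using R c 2 by simp
        ultimately show "c \<in> {c \<in> {i + 1..2 * n}. j \<le> w c}" using c by simp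
      qed
      then have "card {c \<in> {i + 1..2 * n}. j \<le> w_square n c} \<le> card {c \<in> {i + 1..2 * n}. j \<le> w c}"
        by (intro card_mono) auto
      then show ?thesis
        using rank_add_corank[OF w 2(2), of j] rank_add_corank[OF w_square_permutes 2(2), of j]
        by linarith
    next
      case 3
      then show ?thesis using rank_beyond[OF w w_square_permutes] by simp
    qed
  qed
qed

text \<open>The positions \<open>i < n\<close> impose nothing, since \<open>rank (w_up n) i j\<close> is then as small as it can be
  for a permutation.\<close>

lemma rank_w_up_le_iff:
  assumes w: "w permutes {1..2 * n}"
  shows "(\<forall>i j. rank (w_up n) i j \<le> rank w i j) \<longleftrightarrow> (\<forall>i\<in>{n + 1..2 * n}. w i + i \<le> 3 * n + 1)"
    (is "?L \<longleftrightarrow> ?R")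
proof
  assume le: ?L
  show ?R
  proof
    fix i assume i: "i \<in> {n + 1..2 * n}"
    let ?C = "\<lambda>v :: nat \<Rightarrow> nat. {c \<in> {i..2 * n}. 3 * n + 2 - i \<le> v c}"
    have i1: "i - 1 \<le> 2 * n" "i - 1 + 1 = i" using i by auto
    have corank: "rank v (i - 1) (3 * n + 2 - i) + card (?C v) =
        card {c \<in> {1..2 * n}. 3 * n + 2 - i \<le> c}" if "v permutes {1..2 * n}" for v
      using rank_add_corank[OF that i1(1), of "3 * n + 2 - i"] unfolding i1(2) .
    have "?C (w_up n) = {}" using i by (auto simp: w_up_high)
    then have "card (?C (w_up n)) = 0" by (simp only: card.empty)
    then have "card (?C w) = 0"
      using corank[OF w] corank[OF w_up_permutes] le[rule_format, of "i - 1" "3 * n + 2 - i"]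
      by linarith
    then have "?C w = {}" by simp
    moreover have "i \<in> {i..2 * n}" using i by simp
    ultimately have "\<not> 3 * n + 2 - i \<le> w i" by blast
    then show "w i + i \<le> 3 * n + 1" by linarith
  qed
next
  assume R: ?R
  show ?L
  proof (intro allI)
    fix i j
    consider "i < n" | "n \<le> i" "i \<le> 2 * n" | "2 * n \<le> i" by linarith
    then show "rank (w_up n) i j \<le> rank w i j"
    proof cases
      case 1
      show ?thesis
      proof (cases "j \<le> i")
        case True
        let ?B = "\<lambda>v :: nat \<Rightarrow> nat. {c \<in> {1..i}. v c < j}"
        have below: "rank v i j + card (?B v) = i" for v
        proof -
          have "card ({c \<in> {1..i}. j \<le> v c} \<union> ?B v) = rank v i j + card (?B v)"
            unfolding rank_def by (rule card_Un_disjoint) auto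
          moreover have "{c \<in> {1..i}. j \<le> v c} \<union> ?B v = {1..i}" by auto
          ultimately have "card {1..i} = rank v i j + card (?B v)" by (simp only:)
          then show ?thesis by simp
        qed
        have "card (?B w) = card (w ` ?B w)"
          by (rule card_image[symmetric]) (rule inj_on_subset[OF permutes_inj[OF w]], simp)
        also have "\<dots> \<le> card {1..<j}"
          by (rule card_mono) (use permutes_in_image[OF w] 1 in force)+
        also have "{1..<j} = ?B (w_up n)" using True 1 by (auto simp: w_up_low)
        finally show ?thesis using below[of w] below[of "w_up n"] by linarith
      next
        case False
        then have "{c \<in> {1..i}. j \<le> w_up n c} = {}" using 1 by (auto simp: w_up_low)
        then have "rank (w_up n) i j = 0" unfolding rank_def by (simp only: card.empty)
        then show ?thesis by simp
      qed
    next
      case 2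
      have "{c \<in> {i + 1..2 * n}. j \<le> w c} \<subseteq> {c \<in> {i + 1..2 * n}. j \<le> w_up n c}"
      proof
        fix c assume c: "c \<in> {c \<in> {i + 1..2 * n}. j \<le> w c}"
        then have "w c + c \<le> 3 * n + 1" using R 2 by simp
        moreover have "w_up n c = 3 * n + 1 - c" "j \<le> w c" using c 2 w_up_high[of n c] by simp_all
        ultimately have "j \<le> w_up n c" by linarith
        then show "c \<in> {c \<in> {i + 1..2 * n}. j \<le> w_up n c}" using c by simp
      qed
      then have "card {c \<in> {i + 1..2 * n}. j \<le> w c} \<le> card {c \<in> {i + 1..2 * n}. j \<le> w_up n c}"
        by (intro card_mono) auto
      then show ?thesis
        using rank_add_corank[OF w 2(2), of j] rank_add_corank[OF w_up_permutes 2(2), of j]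
        by linarith
    next
      case 3
      then show ?thesis using rank_beyond[OF w_up_permutes w] by simp
    qed
  qed
qed

text \<open>The permutation matrices of the interval are those supported on a fixed board, with row \<open>i\<close>
  for the position and column \<open>v\<close> for the value. Rows \<open>i \<le> n\<close> are called low and the others high.\<close>

definition on_board :: "nat \<Rightarrow> nat \<Rightarrow> nat \<Rightarrow> bool" where
  "on_board n i v \<longleftrightarrow> (if i \<le> n then v \<le> n + i else i \<le> n + v \<and> v + i \<le> 3 * n + 1)"

definition board_perms :: "nat \<Rightarrow> (nat \<Rightarrow> nat) set" where
  "board_perms n = {w. w permutes {1..2 * n} \<and> (\<forall>i\<in>{1..2 * n}. on_board n i (w i))}"

lemma bruhat_interval_eq_board_perms:
  "bruhat_interval (2 * n) (w_up n) (w_square n) = board_perms n"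
proof -
  have rows: "{1..2 * n} = {1..n} \<union> {n + 1..2 * n}" by auto
  have board: "(\<forall>i\<in>{1..2 * n}. on_board n i (w i)) \<longleftrightarrow>
      (\<forall>i\<in>{1..n}. w i \<le> n + i) \<and> (\<forall>i\<in>{n + 1..2 * n}. i \<le> n + w i \<and> w i + i \<le> 3 * n + 1)" for w
    unfolding rows ball_Un
    by (intro arg_cong2[where f = "(\<and>)"] ball_cong refl) (simp_all add: on_board_def)
  have "bruhat_le (2 * n) (w_up n) w \<and> bruhat_le (2 * n) w (w_square n) \<longleftrightarrow>
      (\<forall>i\<in>{1..2 * n}. on_board n i (w i))" if w: "w permutes {1..2 * n}" for w
    unfolding bruhat_le_iff_rank_le[OF w_up_permutes w] bruhat_le_iff_rank_le[OF w w_square_permutes]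
      rank_w_up_le_iff[OF w] rank_le_w_square_iff[OF w] board
    by blast
  then show ?thesis unfolding bruhat_interval_def board_perms_def by blast
qed

section \<open>Counting placements row by row\<close>

text \<open>The number of ways to finish a placement when \<open>m\<close> steps remain, \<open>a\<close> of the values above \<open>n\<close>
  and \<open>b\<close> of the values up to \<open>n\<close> are available and unused, and \<open>a + b\<close> rows have been deferred. A step
  makes one new value of each kind available. A high row then takes any available value, after which a
  low row takes an available value above \<open>n\<close> or is deferred. In the end every deferred row receives one of the
  values up to \<open>n\<close>, so no value above \<open>n\<close> may be left over. For \<open>a = 0\<close> the term with \<open>a - 1\<close>
  has the factor \<open>0\<close>.\<close>

fun placements :: "nat \<Rightarrow> nat \<Rightarrow> nat \<Rightarrow> nat" where
  "placements 0 a b = (if a = 0 then fact b else 0)"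
| "placements (Suc m) a b =
     (a + 1) * (a * placements m (a - 1) (b + 1) + placements m a (b + 1)) +
     (b + 1) * ((a + 1) * placements m a b + placements m (a + 1) b)"

text \<open>The permutations on the board that agree with \<open>g\<close> on the rows in \<open>P\<close> and take values up to
  \<open>n\<close> on the deferred rows \<open>D\<close>.\<close>

definition extensions :: "nat \<Rightarrow> nat set \<Rightarrow> (nat \<Rightarrow> nat) \<Rightarrow> nat set \<Rightarrow> (nat \<Rightarrow> nat) set" where
  "extensions n P g D = {w \<in> board_perms n. (\<forall>r\<in>P. w r = g r) \<and> (\<forall>r\<in>D. w r \<le> n)}"

lemma finite_extensions: "finite (extensions n P g D)"
  by (rule finite_subset[of _ "{w. w permutes {1..2 * n}}"])
     (auto simp: extensions_def board_perms_def finite_permutations)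

text \<open>Splitting according to the value in row \<open>r\<close>. The hypotheses say that \<open>A\<close> consists of the
  extensions whose value in row \<open>r\<close> lies in \<open>K\<close>.\<close>

lemma card_extensions_split:
  assumes "finite K" and "r \<notin> P" and "\<And>w. w \<in> A \<Longrightarrow> w r \<in> K"
    and A: "A \<subseteq> extensions n P g D"
    and B: "\<And>c w. c \<in> K \<Longrightarrow> w \<in> extensions n P g D \<Longrightarrow> w r = c \<Longrightarrow> w \<in> A"
  shows "card A = (\<Sum>c\<in>K. card (extensions n (insert r P) (g(r := c)) D))"
proof -
  have "A = (\<Union>c\<in>K. extensions n (insert r P) (g(r := c)) D)" (is "_ = ?U")
  proof
    show "A \<subseteq> ?U"
    proof
      fix w assume "w \<in> A"
      with assms have "w r \<in> K" "w \<in> extensions n (insert r P) (g(r := w r)) D"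
        by (auto simp: extensions_def)
      then show "w \<in> ?U" by blast
    qed
    show "?U \<subseteq> A"
    proof
      fix w assume "w \<in> ?U"
      then obtain c where "c \<in> K" "w \<in> extensions n (insert r P) (g(r := c)) D" by blast
      with \<open>r \<notin> P\<close> have "w \<in> extensions n P g D \<and> w r = c"
        by (auto simp: extensions_def split: if_splits)
      with B \<open>c \<in> K\<close> show "w \<in> A" by blast
    qed
  qed
  moreover have "extensions n (insert r P) (g(r := c)) D \<inter> extensions n (insert r P) (g(r := d)) D = {}"
    if "c \<noteq> d" for c d using that by (auto simp: extensions_def)
  ultimately show ?thesis
    using assms(1) by (simp add: card_UN_disjoint finite_extensions)
qed

lemma extensions_value:
  assumes "w \<in> extensions n P g D" "r \<in> {1..2 * n}" "r \<notin> P"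
  shows "w r \<in> {1..2 * n} - g ` P" "on_board n r (w r)"
proof -
  have p: "w permutes {1..2 * n}" and eq: "\<And>s. s \<in> P \<Longrightarrow> w s = g s"
    using assms(1) by (auto simp: extensions_def board_perms_def)
  have "w r \<noteq> g s" if "s \<in> P" for s
    using injD[OF permutes_inj[OF p], of r s] that eq[OF that] assms(3) by auto
  then show "w r \<in> {1..2 * n} - g ` P" using permutes_in_image[OF p, of r] assms(2) by auto
  show "on_board n r (w r)" using assms by (auto simp: extensions_def board_perms_def)
qed


lemma image_fun_upd_insert: "r \<notin> P \<Longrightarrow> (g(r := c)) ` insert r P = insert c (g ` P)"
  by (auto simp: image_def)

lemma card_extensions_high_row:
  assumes "r \<in> {n + 1..2 * n}" "r \<notin> P"
  shows "card (extensions n P g D) =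
    (\<Sum>c\<in>{r - n..3 * n + 1 - r} - g ` P. card (extensions n (insert r P) (g(r := c)) D))"
proof (rule card_extensions_split)
  fix w assume w: "w \<in> extensions n P g D"
  have "w r \<in> {1..2 * n} - g ` P" "on_board n r (w r)"
    using extensions_value[OF w, of r] assms by auto
  then show "w r \<in> {r - n..3 * n + 1 - r} - g ` P" using assms by (auto simp: on_board_def)
qed (use assms in auto)

lemma card_extensions_low_row:
  assumes "s \<in> {1..n}" "s \<notin> P"
  shows "card (extensions n P g D) =
    (\<Sum>c\<in>{n + 1..n + s} - g ` P. card (extensions n (insert s P) (g(s := c)) D)) +
    card (extensions n P g (insert s D))"
proof -
  let ?A = "extensions n P g D" and ?B = "extensions n P g (insert s D)"
  have sub: "?B \<subseteq> ?A" by (auto simp: extensions_def)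
  have "card (?A - ?B) =
      (\<Sum>c\<in>{n + 1..n + s} - g ` P. card (extensions n (insert s P) (g(s := c)) D))"
  proof (rule card_extensions_split)
    fix w assume w: "w \<in> ?A - ?B"
    then have "w s > n" by (auto simp: extensions_def)
    moreover have "w s \<in> {1..2 * n} - g ` P" "on_board n s (w s)"
      using extensions_value[of w n P g D s] w assms by auto
    ultimately show "w s \<in> {n + 1..n + s} - g ` P" using assms by (auto simp: on_board_def)
  next
    fix c w assume "c \<in> {n + 1..n + s} - g ` P" "w \<in> ?A" "w s = c"
    then have "w \<notin> ?B" by (auto simp: extensions_def)
    with \<open>w \<in> ?A\<close> show "w \<in> ?A - ?B" by blast
  qed (use assms in auto)
  moreover have "card ?A = card (?A - ?B) + card ?B"
    using card_Diff_subset[OF finite_extensions sub] card_mono[OF finite_extensions sub] by linarith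
  ultimately show ?thesis by simp
qed

text \<open>A placement \<open>g\<close> of the rows in \<open>P\<close> on the board, with distinct values from \<open>V\<close>, together
  with a set \<open>D\<close> of deferred low rows.\<close>

definition partial_placement :: "nat \<Rightarrow> nat set \<Rightarrow> nat set \<Rightarrow> (nat \<Rightarrow> nat) \<Rightarrow> nat set \<Rightarrow> bool" where
  "partial_placement n V P g D \<longleftrightarrow>
     inj_on g P \<and> g ` P \<subseteq> V \<and> P \<inter> D = {} \<and> D \<subseteq> {1..n} \<and> (\<forall>r\<in>P. on_board n r (g r))"

lemma partial_placement_insert:
  assumes "partial_placement n V P g D" "r \<notin> P \<union> D" "c \<in> V - g ` P" "on_board n r c"
  shows "partial_placement n V (insert r P) (g(r := c)) D"
proof -
  have "inj_on (g(r := c)) (insert r P)"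
    using assms by (auto simp: partial_placement_def inj_on_def image_def)
  moreover have "(g(r := c)) ` insert r P = insert c (g ` P)"
    using assms(2) by (intro image_fun_upd_insert) blast
  ultimately show ?thesis using assms unfolding partial_placement_def by auto
qed

lemma partial_placement_defer:
  assumes "partial_placement n V P g D" "s \<notin> P \<union> D" "s \<in> {1..n}"
  shows "partial_placement n V P g (insert s D)"
  using assms unfolding partial_placement_def by blast

lemma partial_placement_mono:
  assumes "partial_placement n V P g D" "V \<subseteq> V'"
  shows "partial_placement n V' P g D"
  using assms unfolding partial_placement_def by blast

text \<open>Once all values above \<open>n\<close> are used, every assignment of the remaining values to the deferred rows
  is on the board.\<close>

lemma card_extensions_only_deferred:
  assumes "finite D" "partial_placement n {1..2 * n} P g D" "P \<union> D = {1..2 * n}"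
    "{n + 1..2 * n} \<subseteq> g ` P"
  shows "card (extensions n P g D) = fact (card D)"
  using assms
proof (induction D arbitrary: P g rule: finite_induct)
  case empty
  then have P: "P = {1..2 * n}" by simp
  have inj: "inj_on g P" and gP: "g ` P \<subseteq> P" and board: "\<forall>r\<in>P. on_board n r (g r)"
    using empty.prems(1) by (auto simp: partial_placement_def P)
  define w where "w = (\<lambda>i. if i \<in> P then g i else i)"
  have "bij_betw g P P"
    using inj gP P endo_inj_surj[of P g] by (auto simp: bij_betw_def)
  then have "bij_betw w P P" by (rule bij_betw_cong[THEN iffD1, rotated]) (simp add: w_def)
  then have w: "w permutes {1..2 * n}" unfolding P[symmetric] by (rule bij_imp_permutes) (simp add: w_def)
  have "extensions n P g {} = {w}"
  proof -
    have "v = w" if "v \<in> extensions n P g {}" for v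
      using that permutes_not_in[of v P] P
      by (auto simp: extensions_def board_perms_def w_def fun_eq_iff)
    moreover have "w \<in> extensions n P g {}"
      using w board P by (auto simp: extensions_def board_perms_def w_def)
    ultimately show ?thesis by blast
  qed
  then show ?case by simp
next
  case (insert r D)
  let ?K = "{1..2 * n} - g ` P"
  have pp: "inj_on g P" "g ` P \<subseteq> {1..2 * n}" "P \<inter> insert r D = {}" "insert r D \<subseteq> {1..n}"
    using insert.prems(1) by (simp_all add: partial_placement_def)
  have pD: "partial_placement n {1..2 * n} P g D"
    using insert.prems(1) by (simp add: partial_placement_def)
  have "finite (P \<union> insert r D)" unfolding insert.prems(2) by simp
  then have fP: "finite P" by simp
  have r: "r \<in> {1..2 * n}" "r \<notin> P" "r \<le> n" using pp by auto
  have K_low: "c \<le> n" if "c \<in> ?K" for c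
  proof -
    have "c \<notin> {n + 1..2 * n}" using insert.prems(3) that by blast
    then show ?thesis using that by auto
  qed
  have "card P + card (insert r D) = 2 * n"
    using card_Un_disjoint[of P "insert r D"] insert.hyps insert.prems(2) pp(3) fP by simp
  then have cK: "card ?K = card (insert r D)"
    using card_Diff_subset[of "g ` P" "{1..2 * n}"] card_image[OF pp(1)] pp(2) fP by simp
  have "card (extensions n P g (insert r D)) = (\<Sum>c\<in>?K. card (extensions n (insert r P) (g(r := c)) D))"
  proof (rule card_extensions_split)
    fix w assume "w \<in> extensions n P g (insert r D)"
    then show "w r \<in> ?K" by (rule extensions_value(1)) (use r in auto)
  next
    show "extensions n P g (insert r D) \<subseteq> extensions n P g D" by (auto simp: extensions_def)
  next
    fix c w assume "c \<in> ?K" "w \<in> extensions n P g D" "w r = c"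
    then show "w \<in> extensions n P g (insert r D)" using K_low[of c] by (simp add: extensions_def)
  qed (use r in auto)
  also have "\<dots> = (\<Sum>c\<in>?K. fact (card D))"
  proof (rule sum.cong[OF refl])
    fix c assume c: "c \<in> ?K"
    have "on_board n r c" using r K_low[OF c] by (simp add: on_board_def)
    show "card (extensions n (insert r P) (g(r := c)) D) = fact (card D)"
    proof (rule insert.IH)
      show "partial_placement n {1..2 * n} (insert r P) (g(r := c)) D"
        using pD r insert.hyps(2) c \<open>on_board n r c\<close> by (intro partial_placement_insert) auto
      show "insert r P \<union> D = {1..2 * n}" using insert.prems(2) by blast
      show "{n + 1..2 * n} \<subseteq> (g(r := c)) ` insert r P"
        unfolding image_fun_upd_insert[OF r(2)] using insert.prems(3) by blast
    qed
  qed
  also have "\<dots> = fact (card (insert r D))" using cK insert.hyps by simp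
  finally show ?case .
qed

text \<open>After \<open>t\<close> steps the rows \<open>{1..t}\<close> and \<open>{2 * n - t + 1..2 * n}\<close> have been treated, from the
  outside inwards, and the values \<open>{n - t + 1..n + t}\<close> are available, from the middle outwards. The next
  high row \<open>2 * n - t\<close> may take exactly the values in \<open>{n - t..n + t + 1}\<close>, and the next low row \<open>t + 1\<close>
  those in \<open>{1..n + t + 1}\<close>. The count therefore depends on the numbers of unused available values
  only.\<close>

lemma card_extensions:
  assumes "t + m = n" "partial_placement n {n - t + 1..n + t} P g D"
    "P \<union> D = {1..t} \<union> {2 * n - t + 1..2 * n}"
    "card ({n + 1..n + t} - g ` P) = a" "card ({n - t + 1..n} - g ` P) = b"
  shows "card (extensions n P g D) = placements m a b"
  using assms
proof (induction m arbitrary: t P D g a b)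
  case 0
  then have t: "t = n" by simp
  have "finite (P \<union> D)" unfolding 0(3) by simp
  then have fin: "finite P" "finite D" by simp_all
  have "{1..n} \<union> {2 * n - n + 1..2 * n} = {1..2 * n}" by auto
  then have PD: "P \<union> D = {1..2 * n}" using 0(3) unfolding t by (rule trans[rotated])
  have pp: "partial_placement n {1..2 * n} P g D" using 0(2) by (simp add: t mult_2)
  have a: "card ({n + 1..2 * n} - g ` P) = a" using 0(4) by (simp add: t mult_2)
  show ?case
  proof (cases "{n + 1..2 * n} \<subseteq> g ` P")
    case True
    have "{1..2 * n} = {1..n} \<union> {n + 1..2 * n}" by auto
    then have "{1..n} - g ` P = {1..2 * n} - g ` P" using True by blast
    then have "b = card ({1..2 * n} - g ` P)" using 0(5) by (simp add: t)
    also have "\<dots> = card {1..2 * n} - card P"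
      using card_Diff_subset[of "g ` P" "{1..2 * n}"] card_image[of g P] pp fin
      by (simp add: partial_placement_def)
    also have "\<dots> = card D"
      using card_Un_disjoint[of P D] fin pp unfolding PD[symmetric] by (simp add: partial_placement_def)
    finally have "b = card D" .
    moreover have "{n + 1..2 * n} - g ` P = {}" using True by blast
    then have "a = 0" using a by (metis card.empty)
    ultimately show ?thesis using card_extensions_only_deferred[OF fin(2) pp PD True] by simp
  next
    case False
    then obtain v where v: "v \<in> {n + 1..2 * n}" "v \<notin> g ` P" by blast
    have "w \<notin> extensions n P g D" for w
    proof
      assume w: "w \<in> extensions n P g D"
      then have p: "w permutes {1..2 * n}" by (simp add: extensions_def board_perms_def)
      obtain r where r: "v = w r" using permutes_surj[OF p] by (metis surjD)
      have "r \<in> {1..2 * n}" using v(1) permutes_in_image[OF p, of r] r by auto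
      moreover have "r \<notin> P" using w v(2) r by (auto simp: extensions_def)
      ultimately have "r \<in> D" using PD by blast
      then show False using w v(1) r by (auto simp: extensions_def)
    qed
    then have "extensions n P g D = {}" by blast
    moreover have "a > 0" unfolding a[symmetric] card_gt_0_iff using v by blast
    ultimately show ?thesis by simp
  qed
next
  case (Suc m)
  let ?r = "2 * n - t" and ?s = "Suc t" and ?V = "{n - t..n + t + 1}"
  let ?H = "{n + 1..n + t + 1}" and ?L = "{n - t..n}"
  let ?R = "{1..Suc t} \<union> {2 * n - Suc t + 1..2 * n}"
  have tn: "t < n" using Suc.prems(1) by simp
  have e: "n - Suc t + 1 = n - t" "2 * n - Suc t + 1 = ?r" "n + Suc t = n + t + 1"
    using tn by auto
  have rows: "insert ?s (insert ?r (P \<union> D)) = ?R"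
  proof -
    have "{1..Suc t} = insert ?s {1..t}" by auto
    moreover have "{?r..2 * n} = insert ?r {?r + 1..2 * n}" using tn by auto
    ultimately show ?thesis using Suc.prems(3) unfolding e by blast
  qed
  have r: "?r \<notin> P \<union> D" unfolding Suc.prems(3) using tn by auto
  moreover have "?s \<notin> P \<union> D" unfolding Suc.prems(3) using tn by auto
  moreover have "?s \<noteq> ?r" using tn by auto
  ultimately have s: "?s \<notin> insert ?r P \<union> D" by blast
  have "n + t + 1 \<notin> {n - t + 1..n + t}" "n - t \<notin> {n - t + 1..n + t}" by auto
  then have new: "n + t + 1 \<notin> g ` P" "n - t \<notin> g ` P"
    using Suc.prems(2) unfolding partial_placement_def by blast+
  have H: "?H = insert (n + t + 1) {n + 1..n + t}" by auto
  have "?H - g ` P = insert (n + t + 1) ({n + 1..n + t} - g ` P)"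
    unfolding H insert_Diff_if using new by simp
  then have cH: "card (?H - g ` P) = a + 1" using Suc.prems(4) by simp
  have L: "?L = insert (n - t) {n - t + 1..n}" using tn by auto
  have "?L - g ` P = insert (n - t) ({n - t + 1..n} - g ` P)"
    unfolding L insert_Diff_if using new by simp
  then have cL: "card (?L - g ` P) = b + 1" using Suc.prems(5) by simp
  have pp: "partial_placement n ?V P g D"
    using Suc.prems(2) by (rule partial_placement_mono) auto
  have next_stage: "card (extensions n P' g' D') = placements m a' b'"
    if "partial_placement n ?V P' g' D'" "P' \<union> D' = ?R"
      "card (?H - g' ` P') = a'" "card (?L - g' ` P') = b'" for P' g' D' a' b'
  proof -
    have "Suc t + m = n" using Suc.prems(1) by simp
    from Suc.IH[of "Suc t", unfolded e, OF this that[unfolded e]] show ?thesis .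
  qed
  have low_row: "card (extensions n (insert ?r P) (g(?r := c)) D) =
      a' * placements m (a' - 1) b' + placements m a' b'"
    if c: "c \<in> ?V - g ` P" and a': "card (?H - insert c (g ` P)) = a'"
      and b': "card (?L - insert c (g ` P)) = b'" for c a' b'
  proof -
    let ?P = "insert ?r P" and ?g = "g(?r := c)"
    have img: "?g ` ?P = insert c (g ` P)" using r by (intro image_fun_upd_insert) blast
    have "on_board n ?r c" using c tn by (auto simp: on_board_def)
    then have pr: "partial_placement n ?V ?P ?g D"
      by (rule partial_placement_insert[OF pp r c])
    have "card (extensions n (insert ?s ?P) (?g(?s := d)) D) = placements m (a' - 1) b'"
      if d: "d \<in> ?H - insert c (g ` P)" for d
    proof (rule next_stage)
      have img': "(?g(?s := d)) ` insert ?s ?P = insert d (insert c (g ` P))"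
        unfolding img[symmetric] using s by (intro image_fun_upd_insert) blast
      have "on_board n ?s d" using d tn by (auto simp: on_board_def)
      moreover have "d \<in> ?V - ?g ` ?P" using d unfolding img by auto
      ultimately show "partial_placement n ?V (insert ?s ?P) (?g(?s := d)) D"
        using partial_placement_insert[OF pr s] by blast
      show "insert ?s ?P \<union> D = ?R" using rows by simp
      have "?H - insert d (insert c (g ` P)) = (?H - insert c (g ` P)) - {d}" by blast
      then show "card (?H - (?g(?s := d)) ` insert ?s ?P) = a' - 1"
        unfolding img' using d a' by simp
      have "?L - insert d (insert c (g ` P)) = ?L - insert c (g ` P)" using d by auto
      then show "card (?L - (?g(?s := d)) ` insert ?s ?P) = b'"
        unfolding img' using b' by simp
    qed
    moreover have "card (extensions n ?P ?g (insert ?s D)) = placements m a' b'"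
    proof (rule next_stage)
      show "partial_placement n ?V ?P ?g (insert ?s D)"
        by (rule partial_placement_defer[OF pr s]) (use tn in simp)
      show "?P \<union> insert ?s D = ?R" using rows by simp
    qed (use a' b' img in simp_all)
    moreover have "card (extensions n ?P ?g D) =
        (\<Sum>d\<in>?H - insert c (g ` P). card (extensions n (insert ?s ?P) (?g(?s := d)) D)) +
        card (extensions n ?P ?g (insert ?s D))"
      using card_extensions_low_row[of ?s n ?P ?g D] s tn unfolding img by simp
    ultimately show ?thesis using a' by simp
  qed
  have "{?r - n..3 * n + 1 - ?r} = ?H \<union> ?L" using tn by auto
  then have "card (extensions n P g D) =
      (\<Sum>c\<in>(?H - g ` P) \<union> (?L - g ` P). card (extensions n (insert ?r P) (g(?r := c)) D))"
    using card_extensions_high_row[of ?r n P g D] r tn by (simp add: Un_Diff)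
  also have "\<dots> = (\<Sum>c\<in>?H - g ` P. card (extensions n (insert ?r P) (g(?r := c)) D)) +
      (\<Sum>c\<in>?L - g ` P. card (extensions n (insert ?r P) (g(?r := c)) D))"
    by (rule sum.union_disjoint) auto
  also have "(\<Sum>c\<in>?H - g ` P. card (extensions n (insert ?r P) (g(?r := c)) D)) =
      (\<Sum>c\<in>?H - g ` P. a * placements m (a - 1) (b + 1) + placements m a (b + 1))"
  proof (rule sum.cong[OF refl], rule low_row)
    fix c assume c: "c \<in> ?H - g ` P"
    have "?H - insert c (g ` P) = (?H - g ` P) - {c}" "?L - insert c (g ` P) = ?L - g ` P"
      using c by auto
    then show "card (?H - insert c (g ` P)) = a" "card (?L - insert c (g ` P)) = b + 1"
      using c cH cL by simp_all
  qed auto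
  also have "(\<Sum>c\<in>?L - g ` P. card (extensions n (insert ?r P) (g(?r := c)) D)) =
      (\<Sum>c\<in>?L - g ` P. (a + 1) * placements m (a + 1 - 1) b + placements m (a + 1) b)"
  proof (rule sum.cong[OF refl], rule low_row)
    fix c assume c: "c \<in> ?L - g ` P"
    have "?L - insert c (g ` P) = (?L - g ` P) - {c}" "?H - insert c (g ` P) = ?H - g ` P"
      using c by auto
    then show "card (?H - insert c (g ` P)) = a + 1" "card (?L - insert c (g ` P)) = b"
      using c cH cL by simp_all
  qed auto
  finally show ?case unfolding sum_constant cH cL by simp
qed

lemma card_board_perms: "card (board_perms n) = placements n 0 0"
  using card_extensions[of 0 n n "{}" id "{}" 0 0] by (simp add: extensions_def partial_placement_def)

section \<open>A difference operator that solves the recursion\<close>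

text \<open>The forward difference of \<open>j (j + 1) h(j)\<close>.\<close>

definition genocchi_op :: "(nat \<Rightarrow> int) \<Rightarrow> nat \<Rightarrow> int" where
  "genocchi_op h j = (int j + 1) * (int j + 2) * h (Suc j) - int j * (int j + 1) * h j"

lemma genocchi_op_scale: "genocchi_op (\<lambda>j. c * h j) = (\<lambda>j. c * genocchi_op h j)"
  by (simp add: genocchi_op_def fun_eq_iff algebra_simps)

text \<open>The product of the falling factorial \<open>j (j - 1) \<dots> (j - a + 1)\<close> and the rising factorial
  \<open>(j + 1) (j + 2) \<dots> (j + b)\<close>.\<close>

definition weight :: "nat \<Rightarrow> nat \<Rightarrow> nat \<Rightarrow> int" where
  "weight a b j = (\<Prod>i<a. int j - int i) * (\<Prod>i<b. int j + 1 + int i)"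

lemma genocchi_op_funpow_add: "(genocchi_op ^^ m) (\<lambda>j. g j + h j) = (\<lambda>j. (genocchi_op ^^ m) g j + (genocchi_op ^^ m) h j)"
proof (induction m arbitrary: g h)
  case (Suc m)
  have "genocchi_op (\<lambda>j. g j + h j) = (\<lambda>j. genocchi_op g j + genocchi_op h j)"
    by (simp add: genocchi_op_def fun_eq_iff algebra_simps)
  then show ?case by (simp add: funpow_Suc_right Suc.IH del: funpow.simps)
qed simp

lemma genocchi_op_funpow_mult: "(genocchi_op ^^ m) (\<lambda>j. c * h j) = (\<lambda>j. c * (genocchi_op ^^ m) h j)"
proof (induction m arbitrary: h)
  case (Suc m)
  then show ?case by (simp add: funpow_Suc_right genocchi_op_scale del: funpow.simps)
qed simp

lemma falling_Suc: "(\<Prod>i<a. int (Suc j) - int i) * (int j + 1 - int a) = (int j + 1) * (\<Prod>i<a. int j - int i)"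
  by (induction a) (auto simp: algebra_simps)

lemma rising_Suc: "(int j + 1) * (\<Prod>i<b. int (Suc j) + 1 + int i) = (\<Prod>i<b. int j + 1 + int i) * (int j + 1 + int b)"
  by (induction b) (auto simp: algebra_simps)

lemma weight_defer:
  "int a * weight (a - 1) b j + weight a b j = (\<Prod>i<a. int (Suc j) - int i) * (\<Prod>i<b. int j + 1 + int i)"
proof -
  have "int a * (\<Prod>i<a - 1. int j - int i) + (\<Prod>i<a. int j - int i) = (\<Prod>i<a. int (Suc j) - int i)"
  proof (cases a)
    case (Suc k)
    have "(\<Prod>i<Suc k. int (Suc j) - int i) = (int j + 1) * (\<Prod>i<k. int j - int i)"
      using falling_Suc[of j k] by (simp add: add.commute)
    then show ?thesis using Suc by (simp add: algebra_simps)
  qed simp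
  from this[symmetric] show ?thesis by (simp add: weight_def algebra_simps)
qed

text \<open>The operator acts on the weights by the recursion of \<open>placements\<close>; this is the identity
  \<open>(j + 2) (j + 1 + b) - j (j + 1 - a) = (a + 1) (j + 1 + b) + (b + 1) (j + 1 - a)\<close> up to common
  factors.\<close>

lemma genocchi_op_weight:
  "genocchi_op (weight a b) j =
     (int a + 1) * (int a * weight (a - 1) (b + 1) j + weight a (b + 1) j) +
     (int b + 1) * ((int a + 1) * weight a b j + weight (a + 1) b j)"
proof -
  let ?P = "\<Prod>i<a. int (Suc j) - int i" and ?Q = "\<Prod>i<b. int j + 1 + int i"
  have 1: "int a * weight (a - 1) (b + 1) j + weight a (b + 1) j = ?P * (?Q * (int j + 1 + int b))"
    unfolding weight_defer by simp
  have 2: "(int a + 1) * weight a b j + weight (a + 1) b j = ?P * (int j + 1 - int a) * ?Q"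
    using weight_defer[of "a + 1" b j] by (simp add: add.commute)
  have 3: "(int j + 1) * weight a b (Suc j) = ?P * (?Q * (int j + 1 + int b))"
    unfolding weight_def rising_Suc[symmetric] by (simp add: algebra_simps)
  have 4: "(int j + 1) * weight a b j = ?P * (int j + 1 - int a) * ?Q"
    unfolding weight_def falling_Suc by (simp add: algebra_simps)
  have "genocchi_op (weight a b) j = (int j + 2) * ((int j + 1) * weight a b (Suc j)) - int j * ((int j + 1) * weight a b j)"
    by (simp add: genocchi_op_def algebra_simps)
  then show ?thesis unfolding 1 2 3 4 by (simp add: algebra_simps)
qed

text \<open>At \<open>j = 0\<close> the weight vanishes unless \<open>a = 0\<close>, and then it is \<open>b!\<close>.\<close>

lemma placements_genocchi_op: "int (placements m a b) = (genocchi_op ^^ m) (weight a b) 0"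
proof (induction m arbitrary: a b)
  case 0
  have "(\<Prod>i<a. - int i) = (if a = 0 then 1 else 0)" by (cases a) (auto simp: lessThan_Suc_eq_insert_0)
  moreover have "(\<Prod>i<b. 1 + int i) = int (fact b)" by (induction b) (simp_all add: algebra_simps)
  ultimately show ?case by (simp add: weight_def)
next
  case (Suc m)
  show ?case
    unfolding funpow_Suc_right o_def genocchi_op_weight[abs_def]
    by (simp add: genocchi_op_funpow_add genocchi_op_funpow_mult Suc.IH algebra_simps)
qed

lemma placements_median: "int (placements n 0 0) = (genocchi_op ^^ n) (\<lambda>_. 1) 0"
  by (simp add: placements_genocchi_op weight_def[abs_def])

section \<open>The Seidel triangle\<close>

text \<open>Let \<open>T\<close> be the operator just studied. Multiplication by \<open>x\<close> in the ring extension of \<open>\<int>[T]\<close>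
  given by \<open>x (x + 1) = - T\<close>, acting on pairs \<open>(g, h)\<close> that stand for \<open>(x + 1) g + h\<close>.\<close>

definition mulx :: "(nat \<Rightarrow> int) \<times> (nat \<Rightarrow> int) \<Rightarrow> (nat \<Rightarrow> int) \<times> (nat \<Rightarrow> int)" where
  "mulx p = (snd p, \<lambda>j. - genocchi_op (fst p) j - snd p j)"

text \<open>Multiplication by \<open>x + 1\<close>.\<close>

definition mulx1 :: "(nat \<Rightarrow> int) \<times> (nat \<Rightarrow> int) \<Rightarrow> (nat \<Rightarrow> int) \<times> (nat \<Rightarrow> int)" where
  "mulx1 p = (\<lambda>j. fst p j + snd p j, \<lambda>j. - genocchi_op (fst p) j)"

text \<open>The numbers \<open>N(x\<^sup>a (x + 1)\<^sup>b)\<close>, where the linear functional \<open>N\<close> takes the first component of a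
  pair at \<open>0\<close>, starting from the pair \<open>(0, 1)\<close>.\<close>

definition moment :: "nat \<Rightarrow> nat \<Rightarrow> int" where
  "moment a b = fst ((mulx ^^ a) ((mulx1 ^^ b) (\<lambda>_. 0, \<lambda>_. 1))) 0"

lemma mulx_mulx1: "mulx (mulx1 p) = (\<lambda>j. - genocchi_op (fst p) j, \<lambda>j. - genocchi_op (snd p) j)"
  by (simp add: mulx_def mulx1_def genocchi_op_def fun_eq_iff algebra_simps)

lemma mulx1_mulx: "mulx1 (mulx p) = mulx (mulx1 p)"
  unfolding mulx_mulx1 by (simp add: mulx_def mulx1_def fun_eq_iff)

lemma mulx_funpow_mulx1: "(mulx ^^ a) (mulx1 p) = mulx1 ((mulx ^^ a) p)"
  by (induction a) (simp_all add: mulx1_mulx)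

lemma moment_Suc_right: "moment a (Suc b) = moment (Suc a) b + moment a b"
  by (simp add: moment_def mulx_funpow_mulx1) (simp add: mulx_def mulx1_def)

lemma mulx_mulx1_funpow:
  "(mulx ^^ n) ((mulx1 ^^ n) (\<lambda>_. 0, \<lambda>_. 1)) =
     (\<lambda>_. 0, \<lambda>j. (- 1) ^ n * (genocchi_op ^^ n) (\<lambda>_. 1) j)"
proof (induction n)
  case (Suc n)
  have "(mulx ^^ Suc n) ((mulx1 ^^ Suc n) (\<lambda>_. 0, \<lambda>_. 1)) =
        mulx (mulx1 ((mulx ^^ n) ((mulx1 ^^ n) (\<lambda>_. 0, \<lambda>_. 1))))"
    by (simp add: mulx_funpow_mulx1)
  also have "\<dots> = (\<lambda>_. 0, \<lambda>j. (- 1) ^ Suc n * (genocchi_op ^^ Suc n) (\<lambda>_. 1) j)"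
    by (simp add: Suc.IH mulx_mulx1 genocchi_op_scale) (simp add: genocchi_op_def)
  finally show ?case .
qed simp

lemma moment_diagonal: "moment n n = 0"
  by (simp add: moment_def mulx_mulx1_funpow)

lemma moment_median: "moment (Suc n) n = (- 1) ^ n * (genocchi_op ^^ n) (\<lambda>_. 1) 0"
  by (simp add: moment_def mulx_mulx1_funpow) (simp add: mulx_def)

text \<open>Such pairs are preserved by multiplication by \<open>x\<^sup>2\<close>, after which the first component vanishes at
  \<open>0\<close>. The pair \<open>(1, - 2)\<close>, which represents \<open>x - 1\<close> applied to \<open>(0, 1)\<close>, is of this kind.\<close>

definition edge_pair :: "(nat \<Rightarrow> int) \<times> (nat \<Rightarrow> int) \<Rightarrow> bool" where
  "edge_pair p \<longleftrightarrow> (\<forall>j. (int j + 1) * snd p j = - genocchi_op (fst p) j)"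

lemma fst_mulx_mulx_edge_pair:
  assumes "edge_pair p"
  shows "fst (mulx (mulx p)) j = int j * snd p j"
proof -
  have "(int j + 1) * snd p j = - genocchi_op (fst p) j" using assms unfolding edge_pair_def by blast
  then show ?thesis by (simp add: mulx_def algebra_simps)
qed

lemma edge_pair_mulx_mulx:
  assumes "edge_pair p"
  shows "edge_pair (mulx (mulx p))"
proof -
  have f: "fst (mulx (mulx p)) = (\<lambda>j. int j * snd p j)"
    using fst_mulx_mulx_edge_pair[OF assms] by blast
  have s: "snd (mulx (mulx p)) j = - genocchi_op (snd p) j - int j * snd p j" for j
    using fst_mulx_mulx_edge_pair[OF assms, of j] by (simp add: mulx_def)
  show ?thesis
    unfolding edge_pair_def f s genocchi_op_def by (simp add: algebra_simps)
qed

text \<open>That is, \<open>N((x - 1) x\<^sup>2\<^sup>n) = 0\<close> for \<open>n \<ge> 1\<close>; this matches the repeated last entry of the odd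
  rows of the Seidel triangle.\<close>

lemma moment_edge:
  assumes "n \<ge> 1"
  shows "moment (2 * n + 1) 0 = moment (2 * n) 0"
proof -
  let ?v = "(\<lambda>_. 0, \<lambda>_. 1) :: (nat \<Rightarrow> int) \<times> (nat \<Rightarrow> int)"
  let ?p = "(\<lambda>_. 1, \<lambda>_. - 2) :: (nat \<Rightarrow> int) \<times> (nat \<Rightarrow> int)"
  \<comment> \<open>multiplication by \<open>x\<^sup>a\<close> commutes with passing from \<open>(0, 1)\<close> to \<open>(x - 1) (0, 1)\<close>\<close>
  have diff: "fst ((mulx ^^ Suc a) ?v) j - fst ((mulx ^^ a) ?v) j = fst ((mulx ^^ a) ?p) j \<and>
        snd ((mulx ^^ Suc a) ?v) j - snd ((mulx ^^ a) ?v) j = snd ((mulx ^^ a) ?p) j" for a j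
  proof (induction a arbitrary: j)
    case 0
    show ?case by (simp add: mulx_def genocchi_op_def)
  next
    case (Suc a)
    have "genocchi_op (fst ((mulx ^^ Suc a) ?v)) j - genocchi_op (fst ((mulx ^^ a) ?v)) j =
          genocchi_op (fst ((mulx ^^ a) ?p)) j"
      using Suc[of j] Suc[of "Suc j"] unfolding genocchi_op_def
      by (simp only: flip: Suc[THEN conjunct1]) (simp add: algebra_simps)
    moreover have "fst (mulx q) = snd q" "snd (mulx q) j = - genocchi_op (fst q) j - snd q j" for q
      by (simp_all add: mulx_def)
    ultimately show ?case using Suc[of j] by simp
  qed
  have edge: "edge_pair ((mulx ^^ (2 * k)) ?p)" for k
  proof (induction k)
    case 0
    show ?case by (simp add: edge_pair_def genocchi_op_def algebra_simps)
  next
    case (Suc k)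
    then show ?case using edge_pair_mulx_mulx by simp
  qed
  obtain k where k: "n = Suc k" using assms by (cases n) auto
  have "fst ((mulx ^^ (2 * n)) ?p) 0 = 0"
    using fst_mulx_mulx_edge_pair[OF edge[of k], of 0] by (simp add: k)
  then show ?thesis using diff[of "2 * n" 0] by (simp add: moment_def)
qed

text \<open>Both recurrences of the triangle are instances of \<open>moment_Suc_right\<close>. The odd rows start
  correctly at \<open>i = 0\<close> by \<open>moment_diagonal\<close>, and the even rows, which run from right to left, start
  correctly at \<open>i = n + 1\<close> by \<open>moment_edge\<close>.\<close>

lemma seidel_even_row_moment:
  "1 \<le> i \<Longrightarrow> i \<le> n + 1 \<Longrightarrow> int (seidel (2 * n) i) = (- 1) ^ n * moment (n + i) (n + 1 - i)"
proof (induction n arbitrary: i)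
  case 0
  then have "i = 1" by simp
  then show ?case by (simp add: seidel_0_1[unfolded One_nat_def] moment_def mulx_def)
next
  case (Suc n)
  note outer = Suc.IH
  let ?s = "(- 1) ^ Suc n :: int"
  have odd: "int (seidel (2 * n + 1) k) = ?s * moment (Suc n + k) (Suc n - k)"
    if "k \<le> Suc n" for k
    using that
  proof (induction k)
    case 0
    then show ?case by (simp add: seidel_out_of_range moment_diagonal)
  next
    case (Suc k)
    have "seidel (2 * n + 1) (Suc k) = seidel (2 * n) (Suc k) + seidel (2 * n + 1) k"
      using seidel_odd_row[of "Suc n" "Suc k"] Suc.prems by simp
    moreover have "Suc n - k = Suc (n - k)" "n + 1 - Suc k = n - k" using Suc.prems by auto
    moreover have "moment (Suc n + k) (Suc (n - k)) =
        moment (Suc (Suc n + k)) (n - k) + moment (Suc n + k) (n - k)"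
      by (rule moment_Suc_right)
    ultimately show ?case
      using Suc.IH Suc.prems outer[of "Suc k"] by (simp add: algebra_simps)
  qed
  have last_odd: "seidel (2 * n + 1) (n + 2) = seidel (2 * n + 1) (n + 1)"
    using seidel_odd_row[of "Suc n" "n + 2"] by (simp add: seidel_out_of_range)
  have even: "int (seidel (2 * Suc n) (n + 2 - d)) = ?s * moment (Suc n + (n + 2 - d)) d"
    if "d \<le> Suc n" for d
    using that
  proof (induction d)
    case 0
    have "seidel (2 * Suc n) (n + 2) = seidel (2 * n + 1) (n + 1)"
      using seidel_even_row[of "Suc n" "n + 2"] last_odd by (simp add: seidel_out_of_range)
    then show ?case using odd[of "Suc n"] moment_edge[of "Suc n"]
      by (simp add: mult_2)
  next
    case (Suc d)
    let ?i = "n + 2 - Suc d"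
    have i: "n + 2 - d = Suc ?i" "Suc n - ?i = d" "?i \<le> Suc n" "1 \<le> ?i" using Suc.prems by auto
    have "seidel (2 * Suc n) ?i = seidel (2 * n + 1) ?i + seidel (2 * Suc n) (Suc ?i)"
      using seidel_even_row[of "Suc n" ?i] i by simp
    moreover have "int (seidel (2 * n + 1) ?i) = ?s * moment (Suc n + ?i) d"
      using odd[OF i(3)] unfolding i(2) .
    moreover have "int (seidel (2 * Suc n) (Suc ?i)) = ?s * moment (Suc (Suc n + ?i)) d"
      using Suc.IH Suc.prems unfolding i(1) by simp
    ultimately show ?case
      by (simp only: moment_Suc_right of_nat_add distrib_left)
  qed
  have "n + 2 - (Suc n + 1 - i) = i" using Suc.prems by auto
  then show ?case using even[of "Suc n + 1 - i"] Suc.prems by simp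
qed

lemma median_genocchi_eq: "int (median_genocchi (2 * n + 1)) = (genocchi_op ^^ n) (\<lambda>_. 1) 0"
proof -
  have "int (seidel (2 * n) 1) = (- 1) ^ n * moment (Suc n) n"
    using seidel_even_row_moment[of 1 n] by simp
  also have "\<dots> = ((- 1) ^ n * (- 1) ^ n) * (genocchi_op ^^ n) (\<lambda>_. 1) 0"
    by (simp add: moment_median)
  also have "(- 1) ^ n * (- 1) ^ n = (1 :: int)"
    by (simp flip: power_mult_distrib)
  finally show ?thesis by (simp add: median_genocchi_odd del: One_nat_def)
qed

theorem proposition5p6:
  fixes n :: nat
  assumes "n \<ge> 1"
  shows "card (bruhat_interval (2 * n) (w_up n) (w_square n)) = median_genocchi (2 * n + 1)"
proof -
  have "int (card (board_perms n)) = int (median_genocchi (2 * n + 1))"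
    unfolding card_board_perms placements_median median_genocchi_eq ..
  then show ?thesis by (simp only: bruhat_interval_eq_board_perms of_nat_eq_iff)
qed

end
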